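(* Let $k$ be a field of characteristic zero, let $n\ge r+1$, and let $f_1,\ldots,f_{n-r}$ be forms of the same degree $\ge 2$ in the polynomial ring $R=k[x_1,\ldots,x_r]$. Let $A=k[f_1,\ldots,f_{n-r}]\subset R$. Take new variables $x_{r+1},\ldots,x_n$, let $S=k[x_1,\ldots,x_r,x_{r+1},\ldots,x_n]$, and let $$F=x_{r+1}f_1+\cdots+x_nf_{n-r}\in S.$$ Let $B=k\left[\frac{\partial F}{\partial x_1},\ldots,\frac{\partial F}{\partial x_n}\right]\subset S$ be the $k$-subalgebra of $S$ generated by the partial derivatives of $F$. If $\dim A=r$, then $B$ is polarizable if and only if $A$ is polarizable.
   Context: "$A$ is polarizable" means that the generators $f_1,\ldots,f_{n-r}$ are polarizable in $R$, and "$B$ is polarizable" means that the generators $\frac{\partial F}{\partial x_1},\ldots,\frac{\partial F}{\partial x_n}$ are polarizable in $S$, in the following sense. Let $\mathbf h=h_1,\ldots,h_m$ be forms in a polynomial ring $U=k[y_1,\ldots,y_q]$ and let $P$ be the kernel of $k[T_1,\ldots,T_m]\to U$, $T_j\mapsto h_j$. For $h\in U$ put $dh=\sum_{i=1}^q\frac{\partial h}{\partial y_i}dy_i$ in the free $U$-module $\sum_{i=1}^q U\,dy_i$. The differential syzygy module $\mathfrak{Z}$ is the kernel of the $U$-linear map $\sum_{j=1}^m U\,dT_j\to\sum_{i=1}^q U\,dy_i$, $dT_j\mapsto dh_j$, where $\sum_j U\,dT_j$ is free with basis $dT_1,\ldots,dT_m$. The polar syzygy module $\mathfrak{D}\subset\mathfrak{Z}$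 is the $U$-submodule generated by the vectors $\sum_{j=1}^m\frac{\partial G}{\partial T_j}(\mathbf h)\,dT_j$, $G\in P$. $\mathbf h$ is polarizable if $\mathfrak{D}=\mathfrak{Z}$. *)

theory Defs
  imports "HOL-Library.Poly_Mapping" "HOL-Library.Extended_Nat" "HOL-Algebra.Ideal"
begin

text \<open>
  A polynomial in variables indexed by natural numbers is a finitely supported map from
  exponent vectors to coefficients, with the (convolution) ring structure of
  \<^theory>\<open>HOL-Library.Poly_Mapping\<close>.  Polynomial rings in finitely many variables are
  carved out as subsets of this type, so that the inclusion of the ring in the first \<open>r\<close> variables
  into the ring in the first \<open>n\<close> variables is literally a subset inclusion.
\<close>

type_synonym 'k mpoly = "(nat \<Rightarrow>\<^sub>0 nat) \<Rightarrow>\<^sub>0 'k"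

definition Const :: "'k::zero \<Rightarrow> 'k mpoly" where
  "Const c = Poly_Mapping.single 0 c"

definition Var :: "nat \<Rightarrow> 'k::zero_neq_one mpoly" where
  "Var i = Poly_Mapping.single (Poly_Mapping.single i 1) 1"

definition vars :: "'k::zero mpoly \<Rightarrow> nat set" where
  "vars p = (\<Union>a\<in>Poly_Mapping.keys p. Poly_Mapping.keys a)"

text \<open>The ring \<open>k[x\<^sub>1,\<dots>,x\<^sub>q]\<close>; variables are numbered from \<open>1\<close>.\<close>

definition poly_ring :: "nat \<Rightarrow> 'k::zero mpoly set" where
  "poly_ring q = {p. vars p \<subseteq> {1..q}}"

text \<open>As usual, the zero polynomial is a form of every degree.\<close>

definition form_of_degree :: "nat \<Rightarrow> 'k::zero mpoly \<Rightarrow> bool" where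
  "form_of_degree d p \<longleftrightarrow>
     (\<forall>a\<in>Poly_Mapping.keys p. (\<Sum>i\<in>Poly_Mapping.keys a. Poly_Mapping.lookup a i) = d)"

text \<open>The truncated subtraction in the exponent is harmless: if \<open>i\<close> does not occur in \<open>a\<close>, the
  coefficient vanishes.\<close>

definition pdiff :: "nat \<Rightarrow> 'k::comm_ring_1 mpoly \<Rightarrow> 'k mpoly" where
  "pdiff i p = (\<Sum>a\<in>Poly_Mapping.keys p.
     Poly_Mapping.single (a - Poly_Mapping.single i 1)
       (of_nat (Poly_Mapping.lookup a i) * Poly_Mapping.lookup p a))"

text \<open>\<open>subst_poly h G\<close> is \<open>G(h)\<close>, the image of \<open>G\<close> under the \<open>k\<close>-algebra map \<open>T\<^sub>j \<mapsto> h\<^sub>j\<close>.\<close>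

definition subst_poly :: "(nat \<Rightarrow> 'k::comm_ring_1 mpoly) \<Rightarrow> 'k mpoly \<Rightarrow> 'k mpoly" where
  "subst_poly h G = (\<Sum>a\<in>Poly_Mapping.keys G.
     Const (Poly_Mapping.lookup G a) *
     (\<Prod>j\<in>Poly_Mapping.keys a. h j ^ Poly_Mapping.lookup a j))"

definition k_subalgebra :: "'k::comm_ring_1 mpoly set \<Rightarrow> bool" where
  "k_subalgebra A \<longleftrightarrow> (\<forall>c. Const c \<in> A) \<and>
     (\<forall>x\<in>A. \<forall>y\<in>A. x + y \<in> A) \<and> (\<forall>x\<in>A. \<forall>y\<in>A. x * y \<in> A)"

text \<open>The \<open>k\<close>-algebra \<open>k[h\<^sub>1,\<dots>,h\<^sub>m]\<close>.\<close>

definition gen_algebra :: "nat \<Rightarrow> (nat \<Rightarrow> 'k::comm_ring_1 mpoly) \<Rightarrow> 'k mpoly set" where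
  "gen_algebra m h = k_subalgebra hull (h ` {1..m})"

definition ring_on :: "'a::comm_ring_1 set \<Rightarrow> 'a ring" where
  "ring_on A = \<lparr>carrier = A, mult = (*), one = 1, zero = 0, add = (+)\<rparr>"

text \<open>Krull dimension: supremum of the lengths \<open>l\<close> of chains of prime ideals
  \<open>P\<^sub>0 \<subset> \<dots> \<subset> P\<^sub>l\<close>.  (The zero ring, which plays no role here, gets the value \<open>0\<close>.)\<close>

definition krull_dim :: "('a, 'b) ring_scheme \<Rightarrow> enat" where
  "krull_dim R = Sup {enat l | l.
     \<exists>P. (\<forall>i\<le>l. primeideal (P i) R) \<and> (\<forall>i<l. P i \<subset> P (Suc i))}"

text \<open>
  In the following, \<open>h\<^sub>1,\<dots>,h\<^sub>m\<close> are elements of \<open>U = k[y\<^sub>1,\<dots>,y\<^sub>q]\<close>.  An element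
  \<open>\<Sum>\<^sub>j v\<^sub>j dT\<^sub>j\<close> of the free \<open>U\<close>-module with basis \<open>dT\<^sub>1,\<dots>,dT\<^sub>m\<close> is represented by its coefficient
  function \<open>v\<close>, extended by \<open>0\<close> outside \<open>{1..m}\<close>.
\<close>

definition free_module :: "nat \<Rightarrow> nat \<Rightarrow> (nat \<Rightarrow> 'k::zero mpoly) set" where
  "free_module q m = {v. (\<forall>j\<in>{1..m}. v j \<in> poly_ring q) \<and> (\<forall>j. j \<notin> {1..m} \<longrightarrow> v j = 0)}"

definition submodule_over :: "'a::comm_ring_1 set \<Rightarrow> (nat \<Rightarrow> 'a) set \<Rightarrow> bool" where
  "submodule_over U N \<longleftrightarrow> (\<lambda>j. 0) \<in> N \<and>
     (\<forall>v\<in>N. \<forall>w\<in>N. (\<lambda>j. v j + w j) \<in> N) \<and>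
     (\<forall>u\<in>U. \<forall>v\<in>N. (\<lambda>j. u * v j) \<in> N)"

definition presentation_ideal :: "nat \<Rightarrow> (nat \<Rightarrow> 'k::comm_ring_1 mpoly) \<Rightarrow> 'k mpoly set" where
  "presentation_ideal m h = {G \<in> poly_ring m. subst_poly h G = 0}"

text \<open>The differential \<open>dh = \<Sum>\<^sub>i (\<partial>h/\<partial>y\<^sub>i) dy\<^sub>i\<close>, again as a coefficient function.\<close>

definition differential :: "nat \<Rightarrow> 'k::comm_ring_1 mpoly \<Rightarrow> nat \<Rightarrow> 'k mpoly" where
  "differential q p = (\<lambda>i. if i \<in> {1..q} then pdiff i p else 0)"

definition differential_syzygies ::
  "nat \<Rightarrow> nat \<Rightarrow> (nat \<Rightarrow> 'k::comm_ring_1 mpoly) \<Rightarrow> (nat \<Rightarrow> 'k mpoly) set" where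
  "differential_syzygies q m h =
     {v \<in> free_module q m. (\<lambda>i. \<Sum>j=1..m. v j * differential q (h j) i) = (\<lambda>i. 0)}"

definition polar_syzygies ::
  "nat \<Rightarrow> nat \<Rightarrow> (nat \<Rightarrow> 'k::comm_ring_1 mpoly) \<Rightarrow> (nat \<Rightarrow> 'k mpoly) set" where
  "polar_syzygies q m h = submodule_over (poly_ring q) hull
     {(\<lambda>j. if j \<in> {1..m} then subst_poly h (pdiff j G) else 0) | G. G \<in> presentation_ideal m h}"

definition polarizable :: "nat \<Rightarrow> nat \<Rightarrow> (nat \<Rightarrow> 'k::comm_ring_1 mpoly) \<Rightarrow> bool" where
  "polarizable q m h \<longleftrightarrow> polar_syzygies q m h = differential_syzygies q m h"

end

theory Submission
  imports Defs
begin

text \<open>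
  Write \<open>m = n - r\<close>, let \<open>J\<close> be the Jacobian matrix \<open>(\<partial>f\<^sub>j/\<partial>x\<^sub>i)\<close>, and let \<open>\<^bold>h\<close> be the sequence of partial
  derivatives of \<open>F\<close>.  Then \<open>h\<^sub>r\<^sub>+\<^sub>j = f\<^sub>j\<close>, and \<open>h\<^sub>i = \<Sum>\<^sub>j x\<^sub>r\<^sub>+\<^sub>j \<partial>f\<^sub>j/\<partial>x\<^sub>i\<close> for \<open>i \<le> r\<close>.  A vector \<open>(u, w)\<close> over \<open>S\<close>
  is a differential syzygy of \<open>\<^bold>h\<close> if and only if it is killed by the Hessian matrix of \<open>F\<close>, which has
  the blocks \<open>H\<close>, \<open>J\<^sup>T\<close>, \<open>J\<close> and \<open>0\<close>; that is, \<open>J u = 0\<close> and \<open>H u + J\<^sup>T w = 0\<close>.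

  The hypothesis \<open>dim A = r\<close> forces \<open>u = 0\<close> (\<open>syzygy_low_part_eq_0\<close>).  Indeed, \<open>J u = 0\<close> says that the
  derivation \<open>D = \<Sum>\<^sub>i u\<^sub>i \<partial>/\<partial>x\<^sub>i\<close> kills \<open>A\<close>.  A chain of primes of length \<open>r\<close> in \<open>A\<close> provides \<open>r\<close> algebraically
  independent elements of \<open>A\<close> (\<open>krull_dim_imp_algebraically_independent\<close>).
  If some \<open>u\<^sub>i = D x\<^sub>i\<close> were nonzero, \<open>x\<^sub>i\<close> would be
  transcendental over the constants of \<open>D\<close> (\<open>transcendental_over_constants\<close>, where characteristic zero
  enters), which yields \<open>r + 1\<close> independent elements of \<open>k[x\<^sub>1,\<dots>,x\<^sub>r]\<close>; a dimension count excludes this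
  (\<open>not_algebraically_independent\<close>).
  So the differential syzygies of \<open>\<^bold>h\<close> are the vectors \<open>(0, w)\<close> with \<open>J\<^sup>T w = 0\<close>, and
  comparing coefficients of monomials in \<open>x\<^sub>r\<^sub>+\<^sub>1,\<dots>,x\<^sub>n\<close> shows that they are the \<open>S\<close>-span of the differential
  syzygies of \<open>\<^bold>f\<close>.

  If \<open>A\<close> is polarizable, these generators are polar for \<open>\<^bold>f\<close>, hence polar for \<open>\<^bold>h\<close>, because every relation
  among the \<open>f\<^sub>j\<close> is one among the \<open>h\<^sub>i\<close>; so \<open>B\<close> is polarizable.  If \<open>B\<close> is polarizable, a differential
  syzygy \<open>w\<close> of \<open>\<^bold>f\<close> gives the syzygy \<open>(0, w)\<close> of \<open>\<^bold>h\<close>, which is polar; setting the new variables to zero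
  turns polar syzygies of \<open>\<^bold>h\<close> into polar syzygies of \<open>\<^bold>f\<close> (\<open>at_0_polar_syzygy\<close>) and recovers \<open>w\<close>, so \<open>w\<close> is
  polar.  In both cases the converse inclusion is the chain rule
  (\<open>polar_subset_differential_syzygies\<close>).
\<close>

section \<open>Polynomials as finitely supported maps\<close>

lemma mpoly_induct_single [case_names single add zero]:
  fixes p :: "'k::comm_ring_1 mpoly"
  assumes "\<And>a c. a \<in> Poly_Mapping.keys p \<Longrightarrow> P (Poly_Mapping.single a c)"
    and "\<And>p q. P p \<Longrightarrow> P q \<Longrightarrow> P (p + q)"
    and "P 0"
  shows "P p"
proof -
  have expansion: "p = (\<Sum>a\<in>Poly_Mapping.keys p. Poly_Mapping.single a (Poly_Mapping.lookup p a))"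
    by (rule poly_mapping_eqI) (simp add: lookup_sum lookup_single when_def in_keys_iff)
  have "P (\<Sum>a\<in>K. Poly_Mapping.single a (Poly_Mapping.lookup p a))"
    if "finite K" "K \<subseteq> Poly_Mapping.keys p" for K
    using that by (induction K) (auto intro: assms)
  then show ?thesis
    using expansion by (metis finite_keys order_refl)
qed

lemma Const_0 [simp]: "Const 0 = 0"
  and Const_1 [simp]: "Const 1 = (1 :: 'k::comm_ring_1 mpoly)"
  and Const_add: "Const (a + b) = Const a + (Const b :: 'k mpoly)"
  and Const_mult: "Const (a * b) = Const a * (Const b :: 'k mpoly)"
  by (simp_all add: Const_def single_add mult_single)

lemma Const_eq_0_iff [simp]: "Const c = 0 \<longleftrightarrow> c = 0"
  by (metis Const_def lookup_single_eq lookup_zero single_zero)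

lemma Const_uminus: "Const (- a) = - (Const a :: 'k::comm_ring_1 mpoly)"
  by (simp add: Const_def single_uminus)

lemma Var_power: "Var i ^ e = Poly_Mapping.single (Poly_Mapping.single i e) (1 :: 'k::comm_ring_1)"
  by (induction e) (simp_all add: Var_def mult_single flip: single_add)

lemma single_sum_1:
  assumes "finite I"
  shows "Poly_Mapping.single (\<Sum>i\<in>I. a i) 1 = (\<Prod>i\<in>I. Poly_Mapping.single (a i) (1 :: 'k::comm_ring_1))"
  using assms
proof (induction I)
  case (insert i I)
  then show ?case by (simp add: mult_single flip: insert.IH)
qed simp

lemma single_conv_prod:
  fixes c :: "'k::comm_ring_1"
  shows "Poly_Mapping.single a c
    = Const c * (\<Prod>i\<in>Poly_Mapping.keys a. Var i ^ Poly_Mapping.lookup a i)"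
proof -
  have "a = (\<Sum>i\<in>Poly_Mapping.keys a. Poly_Mapping.single i (Poly_Mapping.lookup a i))"
    by (rule poly_mapping_eqI) (simp add: lookup_sum lookup_single when_def in_keys_iff)
  then have "Poly_Mapping.single a 1
      = (\<Prod>i\<in>Poly_Mapping.keys a. Poly_Mapping.single
            (Poly_Mapping.single i (Poly_Mapping.lookup a i)) (1::'k))"
    by (metis (no_types, lifting) finite_keys prod.cong single_sum_1)
  moreover have "Poly_Mapping.single a c = Const c * Poly_Mapping.single a 1"
    by (simp add: Const_def mult_single)
  ultimately show ?thesis
    by (simp add: Var_power)
qed

lemma poly_ring_iff: "p \<in> poly_ring q \<longleftrightarrow> (\<forall>a\<in>Poly_Mapping.keys p. Poly_Mapping.keys a \<subseteq> {1..q})"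
  by (auto simp: poly_ring_def vars_def)

lemma Const_in_poly_ring [simp]: "Const c \<in> poly_ring q"
  by (simp add: poly_ring_iff Const_def)

lemma zero_in_poly_ring [simp]: "0 \<in> poly_ring q"
  by (simp add: poly_ring_iff)

lemma one_in_poly_ring [simp]: "(1 :: 'k::comm_ring_1 mpoly) \<in> poly_ring q"
  by (simp add: poly_ring_iff)

lemma Var_in_poly_ring: "i \<in> {1..q} \<Longrightarrow> (Var i :: 'k::comm_ring_1 mpoly) \<in> poly_ring q"
  by (simp add: poly_ring_iff Var_def)

lemma poly_ring_add: "p \<in> poly_ring q \<Longrightarrow> p' \<in> poly_ring q \<Longrightarrow> p + p' \<in> poly_ring q"
  using keys_add[of p p'] by (fastforce simp: poly_ring_iff)

lemma poly_ring_mult: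
  fixes p p' :: "'k::comm_ring_1 mpoly"
  assumes "p \<in> poly_ring q" "p' \<in> poly_ring q"
  shows "p * p' \<in> poly_ring q"
  unfolding poly_ring_iff
proof
  fix a assume "a \<in> Poly_Mapping.keys (p * p')"
  then obtain b c where "a = b + c" "b \<in> Poly_Mapping.keys p" "c \<in> Poly_Mapping.keys p'"
    using keys_mult[of p p'] by blast
  then show "Poly_Mapping.keys a \<subseteq> {1..q}"
    using assms keys_add[of b c] unfolding poly_ring_iff by blast
qed

lemma poly_ring_sum: "(\<And>i. i \<in> I \<Longrightarrow> p i \<in> poly_ring q) \<Longrightarrow> (\<Sum>i\<in>I. p i) \<in> poly_ring q"
  by (induction I rule: infinite_finite_induct) (auto intro: poly_ring_add)

lemma poly_ring_prod:
  fixes p :: "'b \<Rightarrow> 'k::comm_ring_1 mpoly"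
  shows "(\<And>i. i \<in> I \<Longrightarrow> p i \<in> poly_ring q) \<Longrightarrow> (\<Prod>i\<in>I. p i) \<in> poly_ring q"
  by (induction I rule: infinite_finite_induct) (auto intro: poly_ring_mult)

lemma poly_ring_power:
  fixes p :: "'k::comm_ring_1 mpoly"
  shows "p \<in> poly_ring q \<Longrightarrow> p ^ e \<in> poly_ring q"
  by (induction e) (auto intro: poly_ring_mult)

lemma poly_ring_mono: "q \<le> q' \<Longrightarrow> poly_ring q \<subseteq> poly_ring q'"
  unfolding poly_ring_def by (auto dest!: subsetD)

text \<open>
  The universal property of \<open>k[y\<^sub>1,\<dots>,y\<^sub>q]\<close> in the form of an induction rule: two
  \<open>k\<close>-algebra maps, or two derivations, agree as soon as they agree on the variables.
\<close>

lemma poly_ring_induct [consumes 1, case_names Const Var add mult]: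
  fixes p :: "'k::comm_ring_1 mpoly"
  assumes "p \<in> poly_ring q"
    and Const: "\<And>c. P (Const c)"
    and Var: "\<And>i. i \<in> {1..q} \<Longrightarrow> P (Var i)"
    and add: "\<And>p p'. p \<in> poly_ring q \<Longrightarrow> p' \<in> poly_ring q \<Longrightarrow> P p \<Longrightarrow> P p' \<Longrightarrow> P (p + p')"
    and mult: "\<And>p p'. p \<in> poly_ring q \<Longrightarrow> p' \<in> poly_ring q \<Longrightarrow> P p \<Longrightarrow> P p' \<Longrightarrow> P (p * p')"
  shows "P p"
proof -
  have one: "P 1"
    using Const[of 1] by simp
  have power: "P (p ^ e)" if "P p" "p \<in> poly_ring q" for p e
    by (induction e) (auto intro: one mult that poly_ring_power)
  have prod: "P (\<Prod>i\<in>I. p i)" if "\<And>i. i \<in> I \<Longrightarrow> P (p i) \<and> p i \<in> poly_ring q"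
    for p :: "nat \<Rightarrow> 'k mpoly" and I
    using that
    by (induction I rule: infinite_finite_induct) (auto intro: one mult poly_ring_prod)
  have "P p \<and> p \<in> poly_ring q"
  proof (induction p rule: mpoly_induct_single)
    case (single a c)
    then have keys: "Poly_Mapping.keys a \<subseteq> {1..q}"
      using assms(1) by (simp add: poly_ring_iff)
    have "(\<Prod>i\<in>Poly_Mapping.keys a. (Var i :: 'k mpoly) ^ Poly_Mapping.lookup a i) \<in> poly_ring q"
      using keys by (intro poly_ring_prod poly_ring_power Var_in_poly_ring) auto
    moreover have "P (\<Prod>i\<in>Poly_Mapping.keys a. Var i ^ Poly_Mapping.lookup a i)"
      using keys by (intro prod conjI power Var poly_ring_power Var_in_poly_ring) auto
    ultimately show ?case
      unfolding single_conv_prod by (auto intro: mult Const poly_ring_mult)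
  next
    case (add p p')
    then show ?case by (auto intro: assms(4) poly_ring_add)
  next
    case zero
    then show ?case using Const[of 0] by simp
  qed
  then show ?thesis ..
qed

section \<open>Derivations and substitution\<close>

lemma pdiff_add: "pdiff i (p + q) = pdiff i p + pdiff i q"
  unfolding pdiff_def
  by (rule setsum_keys_plus_distrib) (simp_all add: distrib_left single_add)

lemma pdiff_single:
  "pdiff i (Poly_Mapping.single a c)
    = Poly_Mapping.single (a - Poly_Mapping.single i 1) (of_nat (Poly_Mapping.lookup a i) * c)"
  by (simp add: pdiff_def)

lemma pdiff_0 [simp]: "pdiff i 0 = 0"
  by (simp add: pdiff_def)

lemma pdiff_Const [simp]: "pdiff i (Const c) = 0"
  by (simp add: Const_def pdiff_single)

lemma pdiff_Var: "pdiff i (Var j) = (if i = j then 1 else 0)"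
  by (simp add: Var_def pdiff_single lookup_single)

lemma pdiff_mult: "pdiff i (p * q) = pdiff i p * q + p * pdiff i q"
proof (induction p rule: mpoly_induct_single)
  case (single a c)
  show ?case
  proof (induction q rule: mpoly_induct_single)
    case (single b e)
    have shift: "a - Poly_Mapping.single i 1 + b = a + b - Poly_Mapping.single i 1"
      if "Poly_Mapping.lookup a i > 0" for a b :: "nat \<Rightarrow>\<^sub>0 nat"
      using that by (intro poly_mapping_eqI) (auto simp: lookup_minus lookup_add lookup_single when_def)
    show ?case
    proof (cases "Poly_Mapping.lookup a i = 0"; cases "Poly_Mapping.lookup b i = 0")
    qed (use shift[of a b] shift[of b a] in \<open>auto simp: mult_single pdiff_single lookup_add
          single_add algebra_simps\<close>)
  qed (simp_all add: pdiff_add distrib_left)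
qed (simp_all add: pdiff_add distrib_right)

lemma pdiff_eq_0:
  assumes "p \<in> poly_ring q" "i \<notin> {1..q}"
  shows "pdiff i p = 0"
  using assms(1) by (induction rule: poly_ring_induct)
    (use assms(2) in \<open>auto simp: pdiff_add pdiff_mult pdiff_Var\<close>)

lemma pdiff_in_poly_ring: "p \<in> poly_ring q \<Longrightarrow> pdiff i p \<in> poly_ring q"
  by (induction rule: poly_ring_induct)
    (auto simp: pdiff_add pdiff_mult pdiff_Var intro: poly_ring_add poly_ring_mult)

definition derivation :: "('k::comm_ring_1 mpoly \<Rightarrow> 'k mpoly) \<Rightarrow> bool" where
  "derivation D \<longleftrightarrow> (\<forall>p q. D (p + q) = D p + D q) \<and> (\<forall>p q. D (p * q) = D p * q + p * D q)
     \<and> (\<forall>c. D (Const c) = 0)"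

lemma derivation_simps:
  assumes "derivation D"
  shows "D (p + q) = D p + D q" and "D (p * q) = D p * q + p * D q" and "D (Const c) = 0"
    and "D 0 = 0"
  using assms Const_0 unfolding derivation_def by metis+

lemma derivation_sum:
  assumes "derivation D"
  shows "D (\<Sum>i\<in>I. p i) = (\<Sum>i\<in>I. D (p i))"
  by (induction I rule: infinite_finite_induct) (simp_all add: derivation_simps[OF assms])

lemma derivation_pdiff: "derivation (pdiff i)"
  by (simp add: derivation_def pdiff_add pdiff_mult)

lemma derivation_combination: "derivation (\<lambda>p. \<Sum>i\<in>I. u i * pdiff i p)"
  unfolding derivation_def
  by (auto simp: pdiff_add pdiff_mult algebra_simps sum.distrib sum_distrib_left sum_distrib_right)

lemma subst_poly_single:
  "subst_poly h (Poly_Mapping.single a c)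
    = Const c * (\<Prod>j\<in>Poly_Mapping.keys a. h j ^ Poly_Mapping.lookup a j)"
  by (simp add: subst_poly_def)

lemma subst_poly_add: "subst_poly h (G + H) = subst_poly h G + subst_poly h H"
  unfolding subst_poly_def
  by (rule setsum_keys_plus_distrib) (simp_all add: Const_add distrib_right)

lemma subst_poly_Const [simp]: "subst_poly h (Const c) = Const c"
  by (simp add: Const_def subst_poly_def)

lemma subst_poly_0 [simp]: "subst_poly h 0 = 0"
  by (simp add: subst_poly_def)

lemma subst_poly_1 [simp]: "subst_poly h 1 = 1"
  using subst_poly_Const[of h 1] by simp

lemma subst_poly_Var [simp]: "subst_poly h (Var i) = h i"
  by (simp add: Var_def subst_poly_single)

lemma subst_poly_mult: "subst_poly h (G * H) = subst_poly h G * subst_poly h H"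
proof (induction G rule: mpoly_induct_single)
  case (single a c)
  show ?case
  proof (induction H rule: mpoly_induct_single)
    case (single b e)
    have extend: "(\<Prod>j\<in>Poly_Mapping.keys a'. h j ^ Poly_Mapping.lookup a' j)
        = (\<Prod>j\<in>Poly_Mapping.keys a \<union> Poly_Mapping.keys b. h j ^ Poly_Mapping.lookup a' j)"
      if "Poly_Mapping.keys a' \<subseteq> Poly_Mapping.keys a \<union> Poly_Mapping.keys b" for a'
      using that by (intro prod.mono_neutral_left) (auto simp: in_keys_iff)
    show ?case
      using extend[of a] extend[of b] extend[OF keys_add]
      by (simp add: mult_single subst_poly_single Const_mult lookup_add power_add prod.distrib
          algebra_simps)
  qed (simp_all add: subst_poly_add distrib_left)
qed (simp_all add: subst_poly_add distrib_right)

lemma subst_poly_sum: "subst_poly h (\<Sum>i\<in>I. G i) = (\<Sum>i\<in>I. subst_poly h (G i))"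
  by (induction I rule: infinite_finite_induct) (simp_all add: subst_poly_add)

lemma subst_poly_in_poly_ring:
  assumes "G \<in> poly_ring m" "\<And>j. j \<in> {1..m} \<Longrightarrow> h j \<in> poly_ring q"
  shows "subst_poly h G \<in> poly_ring q"
  using assms(1) by (induction rule: poly_ring_induct)
    (auto simp: subst_poly_add subst_poly_mult intro: poly_ring_add poly_ring_mult assms(2))

lemma subst_poly_cong:
  assumes "G \<in> poly_ring m" "\<And>j. j \<in> {1..m} \<Longrightarrow> h j = h' j"
  shows "subst_poly h G = subst_poly h' G"
  using assms(1) by (induction rule: poly_ring_induct)
    (auto simp: subst_poly_add subst_poly_mult assms(2))

lemma subst_poly_ident:
  assumes "G \<in> poly_ring m" "\<And>j. j \<in> {1..m} \<Longrightarrow> h j = Var j"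
  shows "subst_poly h G = G"
  using assms(1) by (induction rule: poly_ring_induct)
    (auto simp: subst_poly_add subst_poly_mult assms(2))

lemma subst_poly_subst_poly:
  assumes "G \<in> poly_ring m"
  shows "subst_poly h (subst_poly g G) = subst_poly (\<lambda>j. subst_poly h (g j)) G"
  using assms by (induction rule: poly_ring_induct) (auto simp: subst_poly_add subst_poly_mult)

text \<open>
  The chain rule: as functions of \<open>G\<close>, both sides are derivations along \<open>T\<^sub>j \<mapsto> h\<^sub>j\<close> that vanish on
  constants and agree on the \<open>T\<^sub>j\<close>.
\<close>

lemma derivation_subst_poly:
  assumes D: "derivation D" and "G \<in> poly_ring m"
  shows "D (subst_poly h G) = (\<Sum>j=1..m. subst_poly h (pdiff j G) * D (h j))"
  using assms(2)
proof (induction rule: poly_ring_induct)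
  case (Var i)
  have "(\<Sum>j=1..m. subst_poly h (pdiff j (Var i)) * D (h j))
      = (\<Sum>j=1..m. if j = i then D (h j) else 0)"
    by (intro sum.cong) (auto simp: pdiff_Var)
  then show ?case
    using Var by simp
next
  case (mult p p')
  then show ?case
    by (simp add: pdiff_mult subst_poly_mult subst_poly_add derivation_simps[OF D] algebra_simps
        sum.distrib sum_distrib_left)
qed (simp_all add: derivation_simps[OF D] pdiff_add subst_poly_add sum.distrib distrib_right)

section \<open>Differential and polar syzygies\<close>

lemma differential_syzygies_iff:
  "v \<in> differential_syzygies q m h \<longleftrightarrow> v \<in> free_module q m
     \<and> (\<forall>i\<in>{1..q}. (\<Sum>j=1..m. v j * pdiff i (h j)) = 0)"
proof -
  have "(\<Sum>j=1..m. v j * differential q (h j) i)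
      = (if i \<in> {1..q} then (\<Sum>j=1..m. v j * pdiff i (h j)) else 0)" for i
    by (cases "i \<in> {1..q}") (simp_all add: differential_def del: atLeastAtMost_iff)
  then show ?thesis
    unfolding differential_syzygies_def by (auto simp: fun_eq_iff)
qed

lemma submodule_differential_syzygies:
  "submodule_over (poly_ring q) (differential_syzygies q m h)"
  unfolding submodule_over_def
  by (auto simp: differential_syzygies_iff distrib_right sum.distrib mult.assoc free_module_def
      simp flip: sum_distrib_left intro: poly_ring_add poly_ring_mult)

text \<open>
  Applying \<open>\<partial>/\<partial>y\<^sub>i\<close> to the relation \<open>G(\<^bold>h) = 0\<close> gives, by the chain rule, exactly the \<open>i\<close>-th
  coordinate of the equation that defines a differential syzygy.
\<close>

lemma polar_subset_differential_syzygies: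
  assumes "\<And>j. j \<in> {1..m} \<Longrightarrow> h j \<in> poly_ring q"
  shows "polar_syzygies q m h \<subseteq> differential_syzygies q m h"
  unfolding polar_syzygies_def
proof (intro hull_minimal submodule_differential_syzygies, clarify)
  fix G assume G: "G \<in> presentation_ideal m h"
  then have G': "G \<in> poly_ring m" "subst_poly h G = 0"
    by (simp_all add: presentation_ideal_def)
  then have "(\<Sum>j=1..m. subst_poly h (pdiff j G) * pdiff i (h j)) = 0" for i
    using derivation_subst_poly[OF derivation_pdiff[of i] G'(1), of h] by simp
  then show "(\<lambda>j. if j \<in> {1..m} then subst_poly h (pdiff j G) else 0) \<in> differential_syzygies q m h"
    using assms G' by (auto simp: differential_syzygies_iff free_module_def
        intro!: subst_poly_in_poly_ring[of _ m] pdiff_in_poly_ring)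
qed

lemma submodule_polar_syzygies: "submodule_over (poly_ring q) (polar_syzygies q m h)"
  unfolding polar_syzygies_def
  by (rule hull_in) (auto simp: submodule_over_def)

lemma submodule_over_scale:
  "submodule_over U N \<Longrightarrow> u \<in> U \<Longrightarrow> v \<in> N \<Longrightarrow> (\<lambda>j. u * v j) \<in> N"
  by (simp add: submodule_over_def)

lemma submodule_over_sum:
  assumes "submodule_over U N" "\<And>x. x \<in> X \<Longrightarrow> v x \<in> N"
  shows "(\<lambda>j. \<Sum>x\<in>X. v x j) \<in> N"
  using assms(2)
proof (induction X rule: infinite_finite_induct)
  case (insert x X)
  then show ?case
    using assms(1) unfolding submodule_over_def by (simp add: insert.IH)
qed (use assms(1) in \<open>auto simp: submodule_over_def\<close>)

section \<open>Algebraic independence of a list of polynomials\<close>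

lemma subalgebra_sum:
  assumes "k_subalgebra A" "\<And>i. i \<in> I \<Longrightarrow> p i \<in> A"
  shows "(\<Sum>i\<in>I. p i) \<in> A"
proof -
  have "0 \<in> A"
    using assms(1) Const_0 unfolding k_subalgebra_def by metis
  with assms(2) show ?thesis
    using assms(1) unfolding k_subalgebra_def
    by (induction I rule: infinite_finite_induct) auto
qed

lemma subalgebra_power:
  assumes "k_subalgebra A" "p \<in> A"
  shows "p ^ e \<in> A"
proof -
  have "1 \<in> A"
    using assms(1) Const_1 unfolding k_subalgebra_def by metis
  then show ?thesis
    using assms unfolding k_subalgebra_def by (induction e) auto
qed

text \<open>
  The value at \<open>as\<close> of the polynomial with coefficients \<open>c\<close> and degree less than \<open>N\<close> in each variable.
  Exponent vectors are lists parallel to \<open>as\<close>, so that the recursion isolates the first variable; both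
  uses of algebraic independence below proceed one variable at a time.
\<close>

fun box_poly_value :: "nat \<Rightarrow> 'k::comm_ring_1 mpoly list \<Rightarrow> (nat list \<Rightarrow> 'k) \<Rightarrow> 'k mpoly" where
  "box_poly_value N [] c = Const (c [])"
| "box_poly_value N (a # as) c = (\<Sum>e<N. a ^ e * box_poly_value N as (\<lambda>l. c (e # l)))"

definition exponent_lists :: "nat \<Rightarrow> nat \<Rightarrow> nat list set" where
  "exponent_lists N s = {l. set l \<subseteq> {..<N} \<and> length l = s}"

definition algebraically_independent :: "'k::comm_ring_1 mpoly list \<Rightarrow> bool" where
  "algebraically_independent as \<longleftrightarrow>
     (\<forall>N c. box_poly_value N as c = 0 \<longrightarrow> (\<forall>l\<in>exponent_lists N (length as). c l = 0))"

lemma exponent_lists_0 [simp]: "exponent_lists N 0 = {[]}"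
  by (auto simp: exponent_lists_def)

lemma exponent_lists_Suc: "exponent_lists N (Suc s) = (\<lambda>(e, l). e # l) ` ({..<N} \<times> exponent_lists N s)"
  by (auto simp: exponent_lists_def image_iff length_Suc_conv)

lemma finite_exponent_lists [simp]: "finite (exponent_lists N s)"
  by (simp add: exponent_lists_def finite_lists_length_eq)

lemma card_exponent_lists: "card (exponent_lists N s) = N ^ s"
  by (simp add: exponent_lists_def card_lists_length_eq)

lemma box_poly_value_eq_0:
  assumes "\<And>l. l \<in> exponent_lists N (length as) \<Longrightarrow> c l = 0"
  shows "box_poly_value N as c = 0"
  using assms
proof (induction as arbitrary: c)
  case (Cons a as)
  have "box_poly_value N as (\<lambda>l. c (e # l)) = 0" if "e < N" for e
    using that by (intro Cons.IH Cons.prems) (auto simp: exponent_lists_Suc)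
  then show ?case by simp
qed simp

lemma box_poly_value_in_subalgebra:
  assumes "k_subalgebra A" "set as \<subseteq> A"
  shows "box_poly_value N as c \<in> A"
  using assms(2)
proof (induction as arbitrary: c)
  case Nil
  then show ?case using assms(1) by (simp add: k_subalgebra_def)
next
  case (Cons a as)
  then have "a ^ e * box_poly_value N as (\<lambda>l. c (e # l)) \<in> A" for e
    using assms(1) subalgebra_power[OF assms(1), of a e] by (auto simp: k_subalgebra_def)
  then show ?case
    by (simp add: subalgebra_sum[OF assms(1)])
qed

lemma box_poly_value_conv_monomials:
  "box_poly_value N as c
    = (\<Sum>l\<in>exponent_lists N (length as). Const (c l) * prod_list (map2 (^) as l))"
proof (induction as arbitrary: c)
  case (Cons a as)
  have inj: "inj_on (\<lambda>(e, l). e # l) ({..<N} \<times> exponent_lists N (length as))"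
    by (auto simp: inj_on_def)
  have "box_poly_value N (a # as) c = (\<Sum>e<N. \<Sum>l\<in>exponent_lists N (length as).
      Const (c (e # l)) * prod_list (map2 (^) (a # as) (e # l)))"
    by (simp add: Cons.IH sum_distrib_left algebra_simps)
  also have "\<dots> = (\<Sum>l\<in>exponent_lists N (length (a # as)). Const (c l) * prod_list (map2 (^) (a # as) l))"
    unfolding list.size(4) add_Suc_right add_0_right exponent_lists_Suc sum.reindex[OF inj]
    by (simp add: sum.cartesian_product case_prod_unfold)
  finally show ?case .
qed simp

section \<open>Krull dimension bounds the number of independent elements from below\<close>

lemma primeideal_ring_onD:
  assumes "primeideal P (ring_on A)" "k_subalgebra A"
  shows "P \<subseteq> A" and "0 \<in> P"
    and "\<And>x y. x \<in> P \<Longrightarrow> y \<in> P \<Longrightarrow> x + y \<in> P"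
    and "\<And>x y. x \<in> A \<Longrightarrow> y \<in> P \<Longrightarrow> x * y \<in> P"
    and "\<And>x y. x \<in> A \<Longrightarrow> y \<in> A \<Longrightarrow> x * y \<in> P \<Longrightarrow> x \<in> P \<or> y \<in> P"
    and "\<And>c. Const (c :: 'k::field) \<in> P \<Longrightarrow> c = 0"
proof -
  interpret primeideal P "ring_on A" by fact
  show sub: "P \<subseteq> A"
    using a_subset by (simp add: ring_on_def)
  show "0 \<in> P"
    using additive_subgroup.zero_closed[OF is_additive_subgroup] by (simp add: ring_on_def)
  show "\<And>x y. x \<in> P \<Longrightarrow> y \<in> P \<Longrightarrow> x + y \<in> P"
    using additive_subgroup.a_closed[OF is_additive_subgroup] by (simp add: ring_on_def)
  show mult: "\<And>x y. x \<in> A \<Longrightarrow> y \<in> P \<Longrightarrow> x * y \<in> P"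
    using I_l_closed by (simp add: ring_on_def)
  show "\<And>x y. x \<in> A \<Longrightarrow> y \<in> A \<Longrightarrow> x * y \<in> P \<Longrightarrow> x \<in> P \<or> y \<in> P"
    using I_prime by (simp add: ring_on_def)
  fix c :: 'k assume c: "Const c \<in> P"
  show "c = 0"
  proof (rule ccontr)
    assume "c \<noteq> 0"
    then have "Const (inverse c) * Const c = (1 :: 'k mpoly)"
      by (simp flip: Const_mult)
    then have one: "1 \<in> P"
      using mult[OF _ c, of "Const (inverse c)"] assms(2) by (simp add: k_subalgebra_def)
    have "A \<subseteq> P"
      using mult[OF _ one] by auto
    then show False
      using I_notcarr sub by (auto simp: ring_on_def)
  qed
qed

text \<open>
  Along a chain of primes \<open>P\<^sub>0 \<subset> \<dots> \<subset> P\<^sub>s\<close>, elements \<open>a\<^sub>i \<in> P\<^sub>i - P\<^sub>i\<^sub>-\<^sub>1\<close> are algebraically independent, even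
  modulo \<open>P\<^sub>0\<close>.  Sort a polynomial in them by powers of \<open>a = a\<^sub>1\<close> and let \<open>a\<^sup>e q\<^sub>e\<close> be the lowest term.
  If \<open>a\<^sup>e (q\<^sub>e + a t) \<in> P\<^sub>0\<close>, then \<open>q\<^sub>e + a t \<in> P\<^sub>0 \<subseteq> P\<^sub>1\<close> because \<open>a \<notin> P\<^sub>0\<close>, and hence
  \<open>q\<^sub>e \<in> P\<^sub>1\<close> because \<open>a \<in> P\<^sub>1\<close>; now \<open>q\<^sub>e\<close> is a polynomial in \<open>a\<^sub>2,\<dots>,a\<^sub>s\<close>, for which the shorter chain
  starting at \<open>P\<^sub>1\<close> shows that its coefficients vanish.
\<close>

lemma box_poly_value_in_prime_chain:
  fixes P :: "nat \<Rightarrow> 'k::field mpoly set"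
  assumes A: "k_subalgebra A"
    and "\<And>i. i \<le> length as \<Longrightarrow> primeideal (P i) (ring_on A)"
    and "\<And>i. i < length as \<Longrightarrow> P i \<subseteq> P (Suc i)"
    and "\<And>i. i < length as \<Longrightarrow> as ! i \<in> P (Suc i) - P i"
    and "box_poly_value N as c \<in> P 0"
    and "l \<in> exponent_lists N (length as)"
  shows "c l = 0"
  using assms(2-)
proof (induction as arbitrary: P c l)
  case Nil
  then show ?case
    using primeideal_ring_onD(6)[OF _ A] by auto
next
  case (Cons a as)
  define Q where "Q = P (Suc 0)"
  define q where "q = (\<lambda>e. box_poly_value N as (\<lambda>l. c (e # l)))"
  have prime_P: "primeideal (P 0) (ring_on A)" and prime_Q: "primeideal Q (ring_on A)"
    using Cons.prems(1)[of 0] Cons.prems(1)[of "Suc 0"] by (auto simp: Q_def)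
  note P = primeideal_ring_onD[OF prime_P A] and Q = primeideal_ring_onD[OF prime_Q A]
  have a: "a \<in> Q" "a \<notin> P 0" and PQ: "P 0 \<subseteq> Q"
    using Cons.prems(3)[of 0] Cons.prems(2)[of 0] by (auto simp: Q_def)
  have "a \<in> A"
    using a Q(1) by auto
  have "as ! i \<in> A" if "i < length as" for i
    using Cons.prems(3)[of "Suc i"] primeideal_ring_onD(1)[OF Cons.prems(1)[of "Suc (Suc i)"] A] that
    by auto
  then have "set as \<subseteq> A"
    by (auto simp: in_set_conv_nth)
  then have q_A: "q e \<in> A" for e
    unfolding q_def by (rule box_poly_value_in_subalgebra[OF A])
  have "c (e # l) = 0" if "e < N" "l \<in> exponent_lists N (length as)" for e l
    using that
  proof (induction e arbitrary: l rule: less_induct)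
    case (less e)
    have low: "q e' = 0" if "e' < e" for e'
      unfolding q_def by (rule box_poly_value_eq_0) (use less that in auto)
    define t where "t = (\<Sum>e'\<in>{Suc e..<N}. a ^ (e' - Suc e) * q e')"
    have t_A: "t \<in> A"
      unfolding t_def using A q_A subalgebra_power[OF A \<open>a \<in> A\<close>]
      by (intro subalgebra_sum[OF A]) (auto simp: k_subalgebra_def)
    have split: "{..<N} = {..<e} \<union> insert e {Suc e..<N}"
      using less.prems by auto
    have "box_poly_value N (a # as) c = (\<Sum>e'<N. a ^ e' * q e')"
      by (simp add: q_def)
    also have "\<dots> = a ^ e * q e + (\<Sum>e'\<in>{Suc e..<N}. a ^ e' * q e')"
      unfolding split by (subst sum.union_disjoint) (auto simp: low)
    also have "(\<Sum>e'\<in>{Suc e..<N}. a ^ e' * q e') = a ^ e * (a * t)"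
      unfolding t_def sum_distrib_left
      by (intro sum.cong) (auto simp flip: power_Suc power_add mult.assoc simp: le_Suc_ex)
    finally have "a ^ e * (q e + a * t) \<in> P 0"
      using Cons.prems(4) by (simp add: distrib_left)
    moreover have "a ^ e \<notin> P 0" for e
    proof (induction e)
      case 0
      then show ?case using P(6)[of 1] by auto
    next
      case (Suc e)
      then show ?case
        using P(5)[OF \<open>a \<in> A\<close> subalgebra_power[OF A \<open>a \<in> A\<close>, of e]] a by auto
    qed
    moreover have at: "a * t \<in> A"
      using A \<open>a \<in> A\<close> t_A by (simp add: k_subalgebra_def)
    moreover have "q e + a * t \<in> A"
      using A q_A at by (simp add: k_subalgebra_def)
    ultimately have sum: "q e + a * t \<in> P 0"
      using P(5)[OF subalgebra_power[OF A \<open>a \<in> A\<close>]] by blast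
    have "Const (- 1) * (a * t) \<in> Q"
      using Q(4)[OF _ Q(4)[OF t_A a(1)], of "Const (- 1)"] A
      by (simp add: k_subalgebra_def mult.commute)
    then have "(q e + a * t) + Const (- 1) * (a * t) \<in> Q"
      using sum PQ Q(3) by blast
    then have "q e \<in> Q"
      by (simp add: Const_uminus)
    then show ?case
      using Cons.prems(1-3)[of "Suc _"] less.prems
      by (intro Cons.IH[of "\<lambda>i. P (Suc i)" "\<lambda>l. c (e # l)" l]) (auto simp: q_def Q_def)
  qed
  then show ?case
    using Cons.prems(5) by (auto simp: exponent_lists_Suc)
qed

lemma krull_dim_chain:
  assumes "krull_dim R = enat r" "r \<noteq> 0"
  obtains P where "\<And>i. i \<le> r \<Longrightarrow> primeideal (P i) R" and "\<And>i. i < r \<Longrightarrow> P i \<subset> P (Suc i)"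
proof -
  define L where "L = {enat l | l. \<exists>P. (\<forall>i\<le>l. primeideal (P i) R) \<and> (\<forall>i<l. P i \<subset> P (Suc i))}"
  have Sup: "Sup L = enat r"
    using assms(1) by (simp add: krull_dim_def L_def)
  then have "L \<noteq> {}" "finite L"
    using assms(2) by (auto simp: Sup_enat_def zero_enat_def split: if_splits)
  then have "enat r \<in> L"
    using Sup Max_in[of L] by (simp add: Sup_enat_def)
  then show thesis
    using that by (auto simp: L_def)
qed

lemma krull_dim_imp_algebraically_independent:
  fixes A :: "'k::field mpoly set"
  assumes A: "k_subalgebra A" and "krull_dim (ring_on A) = enat r"
  obtains as where "length as = r" "set as \<subseteq> A" "algebraically_independent as"
proof (cases "r = 0")
  case True
  have "algebraically_independent ([] :: 'k mpoly list)"
    by (simp add: algebraically_independent_def)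
  then show thesis
    using that[of "[]"] True by simp
next
  case False
  then obtain P where P: "\<And>i. i \<le> r \<Longrightarrow> primeideal (P i) (ring_on A)"
    "\<And>i. i < r \<Longrightarrow> P i \<subset> P (Suc i)"
    using krull_dim_chain[OF assms(2)] by metis
  have "\<forall>i. \<exists>a. i < r \<longrightarrow> a \<in> P (Suc i) - P i"
    using P(2) by blast
  then obtain a where a: "\<And>i. i < r \<Longrightarrow> a i \<in> P (Suc i) - P i"
    by metis
  have "set (map a [0..<r]) \<subseteq> A"
  proof clarsimp
    fix i assume "i < r"
    then show "a i \<in> A"
      using a primeideal_ring_onD(1)[OF P(1)[of "Suc i"] A] by auto
  qed
  moreover have "algebraically_independent (map a [0..<r])"
    unfolding algebraically_independent_def
  proof (intro allI impI ballI)
    fix N c l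
    assume "box_poly_value N (map a [0..<r]) c = 0" "l \<in> exponent_lists N (length (map a [0..<r]))"
    then show "c l = 0"
      using P a primeideal_ring_onD(2)[OF P(1)[of 0] A]
      by (intro box_poly_value_in_prime_chain[OF A, of "map a [0..<r]" P]) auto
  qed
  ultimately show thesis
    by (intro that[of "map a [0..<r]"]) auto
qed

section \<open>Elements on which a derivation does not vanish\<close>

lemma derivation_power:
  assumes "derivation D"
  shows "D (x ^ Suc e) = of_nat (Suc e) * x ^ e * D x"
  by (induction e) (simp_all add: derivation_simps[OF assms] algebra_simps)

text \<open>
  In characteristic zero an element \<open>x\<close> with \<open>D x \<noteq> 0\<close> is transcendental over the ring of constants of
  \<open>D\<close>: applying \<open>D\<close> to an algebraic equation for \<open>x\<close> yields \<open>D x\<close> times its formal derivative, an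
  equation of smaller degree.
\<close>

lemma transcendental_over_constants:
  fixes x :: "'k::field_char_0 mpoly"
  assumes D: "derivation D" and "D x \<noteq> 0"
    and "\<And>e. D (q e) = 0" and "(\<Sum>e<N. x ^ e * q e) = 0" and "e < N"
  shows "q e = 0"
  using assms(3-)
proof (induction N arbitrary: q e)
  case (Suc N)
  have "0 = D (\<Sum>e<Suc N. x ^ e * q e)"
    using Suc.prems(2) derivation_simps(4)[OF D] by simp
  also have "\<dots> = (\<Sum>e<Suc N. D (x ^ e) * q e)"
    by (simp only: derivation_sum[OF D] derivation_simps(2)[OF D] Suc.prems(1)) simp
  also have "\<dots> = (\<Sum>e<N. D (x ^ Suc e) * q (Suc e))"
    using derivation_simps(3)[OF D, of 1] by (subst sum.lessThan_Suc_shift) simp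
  also have "\<dots> = D x * (\<Sum>e<N. x ^ e * (of_nat (Suc e) * q (Suc e)))"
    by (simp only: derivation_power[OF D] sum_distrib_left) (simp add: algebra_simps)
  finally have "(\<Sum>e<N. x ^ e * (of_nat (Suc e) * q (Suc e))) = 0"
    using assms(2) by simp
  moreover have "D (of_nat (Suc e) * q (Suc e)) = 0" for e
  proof -
    have "(of_nat (Suc e) :: 'k mpoly) = Const (of_nat (Suc e))"
      by (simp only: Const_def single_of_nat)
    then show ?thesis
      using Suc.prems(1) by (simp only: derivation_simps(2,3)[OF D]) simp
  qed
  ultimately have "of_nat (Suc e) * q (Suc e) = 0" if "e < N" for e
    using Suc.IH[of "\<lambda>e. of_nat (Suc e) * q (Suc e)"] that by blast
  then have higher: "q (Suc e) = 0" if "e < N" for e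
    using that by (metis mult_eq_0_iff of_nat_neq_0)
  have "q 0 = 0"
    using Suc.prems(2) by (subst (asm) sum.lessThan_Suc_shift) (simp add: higher)
  then show ?case
    using higher Suc.prems(3) by (cases e) auto
qed simp

lemma algebraically_independent_Cons:
  fixes x :: "'k::field_char_0 mpoly"
  assumes D: "derivation D" and "D x \<noteq> 0" and "\<And>a. a \<in> set as \<Longrightarrow> D a = 0" and "algebraically_independent as"
  shows "algebraically_independent (x # as)"
  unfolding algebraically_independent_def
proof (intro allI impI ballI)
  fix N c l
  assume sum: "box_poly_value N (x # as) c = 0" and l: "l \<in> exponent_lists N (length (x # as))"
  have "k_subalgebra {p. D p = 0}"
    by (simp add: k_subalgebra_def derivation_simps[OF D])
  then have "D (box_poly_value N as c') = 0" for c'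
    using box_poly_value_in_subalgebra[of "{p. D p = 0}" as] assms(3) by blast
  then have "box_poly_value N as (\<lambda>l. c (e # l)) = 0" if "e < N" for e
    using sum that
    by (intro transcendental_over_constants[OF assms(1,2), of "\<lambda>e. box_poly_value N as (\<lambda>l. c (e # l))"]) simp_all
  then show "c l = 0"
    using assms(4) l by (auto simp: algebraically_independent_def exponent_lists_Suc)
qed

section \<open>At most \<open>r\<close> independent elements in \<open>k[x\<^sub>1,\<dots>,x\<^sub>r]\<close>\<close>

text \<open>
  Gaussian elimination on a family indexed by \<open>X\<close>, rather than a statement about the dimension of a
  span, because distinct power products of the given polynomials may coincide.
\<close>

lemma homogeneous_system_nontrivial_solution:
  fixes M :: "'x \<Rightarrow> 'e \<Rightarrow> 'k::field"
  assumes "finite E" "finite X" "card E < card X"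
  obtains c where "\<exists>x\<in>X. c x \<noteq> 0" and "\<And>e. e \<in> E \<Longrightarrow> (\<Sum>x\<in>X. c x * M x e) = 0"
proof -
  have "\<exists>c. (\<exists>x\<in>X. c x \<noteq> 0) \<and> (\<forall>e\<in>E. (\<Sum>x\<in>X. c x * M x e) = 0)"
    using assms
  proof (induction E arbitrary: X M)
    case empty
    then have "X \<noteq> {}" by auto
    then show ?case by (intro exI[of _ "\<lambda>_. 1"]) auto
  next
    case (insert b E)
    show ?case
    proof (cases "\<forall>x\<in>X. M x b = 0")
      case True
      then show ?thesis
        using insert.IH[of X M] insert.prems insert.hyps by auto
    next
      case False
      then obtain y where y: "y \<in> X" "M y b \<noteq> 0" by blast
      define X' where "X' = X - {y}"
      \<comment> \<open>Equation \<open>b\<close> determines the unknown \<open>y\<close>; substitute it into the other equations.\<close>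
      define M' where "M' = (\<lambda>x e. M x e - M x b / M y b * M y e)"
      have X: "X = insert y X'" "y \<notin> X'" "finite X'"
        using y insert.prems by (auto simp: X'_def)
      have "card E < card X'"
        using insert X by (simp add: X(1))
      then obtain c where c: "\<exists>x\<in>X'. c x \<noteq> 0" "\<forall>e\<in>E. (\<Sum>x\<in>X'. c x * M' x e) = 0"
        using insert.IH[of X' M'] X by blast
      define t where "t = - (\<Sum>x\<in>X'. c x * M x b) / M y b"
      have sum: "(\<Sum>x\<in>X. (c(y := t)) x * M x e) = (\<Sum>x\<in>X'. c x * M' x e)" for e
      proof -
        have "(\<Sum>x\<in>X. (c(y := t)) x * M x e) = t * M y e + (\<Sum>x\<in>X'. (c(y := t)) x * M x e)"
          using X by simp
        also have "(\<Sum>x\<in>X'. (c(y := t)) x * M x e) = (\<Sum>x\<in>X'. c x * M x e)"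
          using X by (intro sum.cong) auto
        also have "t * M y e = - (\<Sum>x\<in>X'. c x * (M x b / M y b * M y e))"
          by (simp add: t_def sum_distrib_right sum_divide_distrib mult.assoc)
        finally show ?thesis
          by (simp add: M'_def right_diff_distrib sum_subtractf)
      qed
      have "M' x b = 0" for x
        using y by (simp add: M'_def)
      then have "\<forall>e\<in>insert b E. (\<Sum>x\<in>X. (c(y := t)) x * M x e) = 0"
        unfolding sum using c(2) by simp
      moreover have "\<exists>x\<in>X. (c(y := t)) x \<noteq> 0"
        using c(1) X by auto
      ultimately show ?thesis
        by blast
    qed
  qed
  then show thesis using that by blast
qed

definition exponent_box :: "nat \<Rightarrow> nat \<Rightarrow> (nat \<Rightarrow>\<^sub>0 nat) set" where
  "exponent_box r M = {a. Poly_Mapping.keys a \<subseteq> {1..r} \<and> (\<forall>i. Poly_Mapping.lookup a i \<le> M)}"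

lemma card_exponent_box: "finite (exponent_box r M) \<and> card (exponent_box r M) \<le> Suc M ^ r"
proof -
  let ?f = "\<lambda>a :: nat \<Rightarrow>\<^sub>0 nat. restrict (Poly_Mapping.lookup a) {1..r}"
  let ?T = "PiE {1..r} (\<lambda>_. {..M})"
  have "a = b" if "a \<in> exponent_box r M" "b \<in> exponent_box r M" "?f a = ?f b" for a b
  proof (rule poly_mapping_eqI)
    fix i
    show "Poly_Mapping.lookup a i = Poly_Mapping.lookup b i"
    proof (cases "i \<in> {1..r}")
      case True
      then show ?thesis using fun_cong[OF that(3), of i] by (simp del: atLeastAtMost_iff)
    next
      case False
      then have "i \<notin> Poly_Mapping.keys a" "i \<notin> Poly_Mapping.keys b"
        using that(1,2) by (auto simp: exponent_box_def)
      then show ?thesis by (simp add: in_keys_iff)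
    qed
  qed
  then have "inj_on ?f (exponent_box r M)"
    by (auto intro: inj_onI)
  moreover have "?f ` exponent_box r M \<subseteq> ?T"
    by (auto simp: exponent_box_def)
  moreover have "finite ?T" "card ?T = Suc M ^ r"
    by (simp_all add: finite_PiE card_PiE)
  ultimately show ?thesis
    using card_inj_on_le[of ?f "exponent_box r M" ?T] inj_on_finite[of ?f "exponent_box r M" ?T]
    by simp
qed

lemma exponent_box_mono: "M \<le> M' \<Longrightarrow> exponent_box r M \<subseteq> exponent_box r M'"
  by (auto simp: exponent_box_def intro: order_trans)

lemma exponent_box_mult:
  fixes p q :: "'k::comm_ring_1 mpoly"
  assumes "Poly_Mapping.keys p \<subseteq> exponent_box r M" "Poly_Mapping.keys q \<subseteq> exponent_box r M'"
  shows "Poly_Mapping.keys (p * q) \<subseteq> exponent_box r (M + M')"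
proof
  fix a assume "a \<in> Poly_Mapping.keys (p * q)"
  then obtain b c where "a = b + c" "b \<in> Poly_Mapping.keys p" "c \<in> Poly_Mapping.keys q"
    using keys_mult[of p q] by blast
  moreover from this have "b \<in> exponent_box r M" "c \<in> exponent_box r M'"
    using assms by auto
  ultimately show "a \<in> exponent_box r (M + M')"
    using keys_add[of b c] by (auto simp: exponent_box_def lookup_add intro: add_mono)
qed

lemma exponent_box_sum:
  assumes "\<And>i. i \<in> I \<Longrightarrow> Poly_Mapping.keys (p i) \<subseteq> exponent_box r M"
  shows "Poly_Mapping.keys (\<Sum>i\<in>I. p i) \<subseteq> exponent_box r M"
  using assms
proof (induction I rule: infinite_finite_induct)
  case (insert i I)
  then have "Poly_Mapping.keys (p i) \<subseteq> exponent_box r M"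
    "Poly_Mapping.keys (\<Sum>i\<in>I. p i) \<subseteq> exponent_box r M" by auto
  with insert.hyps show ?case
    using keys_add[of "p i" "\<Sum>i\<in>I. p i"] by simp blast
qed simp_all

lemma exponent_box_power:
  fixes p :: "'k::comm_ring_1 mpoly"
  assumes "Poly_Mapping.keys p \<subseteq> exponent_box r M"
  shows "Poly_Mapping.keys (p ^ e) \<subseteq> exponent_box r (e * M)"
proof (induction e)
  case 0
  then show ?case by (simp add: exponent_box_def)
next
  case (Suc e)
  then show ?case using exponent_box_mult[OF assms Suc] by simp
qed

lemma exponent_box_box_poly_value:
  assumes "\<And>a. a \<in> set as \<Longrightarrow> Poly_Mapping.keys a \<subseteq> exponent_box r M"
  shows "Poly_Mapping.keys (box_poly_value N as c) \<subseteq> exponent_box r (length as * M * N)"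
  using assms
proof (induction as arbitrary: c)
  case Nil
  then show ?case by (auto simp: exponent_box_def Const_def)
next
  case (Cons a as)
  have "Poly_Mapping.keys (a ^ e * box_poly_value N as (\<lambda>l. c (e # l)))
      \<subseteq> exponent_box r (length (a # as) * M * N)" if "e < N" for e
  proof -
    have "e * M + length as * M * N \<le> length (a # as) * M * N"
      using that by (simp add: algebra_simps)
    moreover have "Poly_Mapping.keys (a ^ e * box_poly_value N as (\<lambda>l. c (e # l)))
        \<subseteq> exponent_box r (e * M + length as * M * N)"
      using Cons by (intro exponent_box_mult exponent_box_power) auto
    ultimately show ?thesis
      using exponent_box_mono by blast
  qed
  then show ?case
    by (simp only: box_poly_value.simps) (intro exponent_box_sum, auto)
qed

text \<open>
  A dimension count.  There are \<open>N\<^sup>r\<^sup>+\<^sup>1\<close> power products of \<open>r + 1\<close> polynomials with every exponent less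
  than \<open>N\<close>, but their degrees in each variable are at most \<open>K N\<close> for a constant \<open>K\<close>, so that they lie
  in a space of dimension at most \<open>(K N + 1)\<^sup>r\<close>.  For large \<open>N\<close> they are linearly dependent.
\<close>

lemma not_algebraically_independent:
  fixes as :: "'k::field mpoly list"
  assumes "set as \<subseteq> poly_ring r" "length as = Suc r"
  shows "\<not> algebraically_independent as"
proof
  assume indep: "algebraically_independent as"
  define X where "X = (\<Union>p\<in>set as. \<Union>a\<in>Poly_Mapping.keys p. Poly_Mapping.lookup a ` Poly_Mapping.keys a)"
  define M where "M = Max (insert 0 X)"
  have "finite X" by (simp add: X_def)
  have box: "Poly_Mapping.keys p \<subseteq> exponent_box r M" if "p \<in> set as" for p
  proof
    fix a assume a: "a \<in> Poly_Mapping.keys p"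
    have "Poly_Mapping.lookup a i \<le> M" for i
    proof (cases "i \<in> Poly_Mapping.keys a")
      case True
      then have "Poly_Mapping.lookup a i \<in> X"
        using a that by (auto simp: X_def)
      then show ?thesis
        using \<open>finite X\<close> by (simp add: M_def)
    qed (simp add: in_keys_iff)
    then show "a \<in> exponent_box r M"
      using that a subsetD[OF assms(1) that] by (simp add: exponent_box_def poly_ring_iff)
  qed
  define K where "K = Suc r * M"
  \<comment> \<open>With this \<open>N\<close>, \<open>(K N + 1)\<^sup>r \<le> (K + 1)\<^sup>r N\<^sup>r < N\<^sup>r\<^sup>+\<^sup>1\<close>.\<close>
  define N where "N = Suc (Suc K ^ r)"
  have "card (exponent_box r (K * N)) \<le> Suc (K * N) ^ r"
    using card_exponent_box by blast
  also have "\<dots> \<le> (Suc K * N) ^ r"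
    by (rule power_mono) (simp_all add: N_def)
  also have "\<dots> = Suc K ^ r * N ^ r"
    by (rule power_mult_distrib)
  also have "\<dots> < N * N ^ r"
    by (rule mult_strict_right_mono) (simp_all add: N_def)
  also have "\<dots> = card (exponent_lists N (Suc r))"
    by (simp add: card_exponent_lists)
  finally obtain c where c: "\<exists>l\<in>exponent_lists N (Suc r). c l \<noteq> 0"
    "\<And>b. b \<in> exponent_box r (K * N) \<Longrightarrow>
      (\<Sum>l\<in>exponent_lists N (Suc r). c l * Poly_Mapping.lookup (prod_list (map2 (^) as l)) b) = 0"
    by (rule homogeneous_system_nontrivial_solution[where M = "\<lambda>l. Poly_Mapping.lookup (prod_list (map2 (^) as l))",
          OF conjunct1[OF card_exponent_box] finite_exponent_lists]) blast
  have "box_poly_value N as c = 0"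
  proof (rule poly_mapping_eqI)
    fix b
    show "Poly_Mapping.lookup (box_poly_value N as c) b = Poly_Mapping.lookup 0 b"
    proof (cases "b \<in> exponent_box r (K * N)")
      case True
      have "Poly_Mapping.lookup (Const x * p) b = x * Poly_Mapping.lookup p b" for x and p :: "'k mpoly"
        unfolding Const_def mult_map_scale_conv_mult[symmetric] by (simp add: map.rep_eq when_def)
      then show ?thesis
        using c(2)[OF True] by (simp add: box_poly_value_conv_monomials lookup_sum assms(2))
    next
      case False
      then have "b \<notin> Poly_Mapping.keys (box_poly_value N as c)"
        using exponent_box_box_poly_value[OF box, of as N c] assms(2) by (auto simp: K_def)
      then show ?thesis by (simp add: in_keys_iff)
    qed
  qed
  then show False
    using indep c(1) assms(2) by (auto simp: algebraically_independent_def)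
qed

text \<open>
  This is how \<open>dim A = r\<close> enters.  If \<open>D\<close> kills \<open>A\<close> but not \<open>x\<^sub>i\<close>, then \<open>x\<^sub>i\<close> is
  transcendental over \<open>A\<close>, and together with \<open>r\<close> independent elements of \<open>A\<close> it makes \<open>r + 1\<close> independent
  elements of \<open>k[x\<^sub>1,\<dots>,x\<^sub>r]\<close>.  The values of \<open>D\<close> may lie in a larger polynomial ring.
\<close>

lemma derivation_vanishing_on_gen_algebra:
  fixes f :: "nat \<Rightarrow> 'k::field_char_0 mpoly"
  assumes dim: "krull_dim (ring_on (gen_algebra m f)) = enat r"
    and f: "\<And>j. j \<in> {1..m} \<Longrightarrow> f j \<in> poly_ring r"
    and D: "derivation D" and Df: "\<And>j. j \<in> {1..m} \<Longrightarrow> D (f j) = 0"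
    and i: "i \<in> {1..r}"
  shows "D (Var i) = 0"
proof (rule ccontr)
  assume "D (Var i) \<noteq> 0"
  have "k_subalgebra (gen_algebra m f)"
    unfolding gen_algebra_def by (rule hull_in) (auto simp: k_subalgebra_def)
  then obtain as where as: "length as = r" "set as \<subseteq> gen_algebra m f" "algebraically_independent as"
    using krull_dim_imp_algebraically_independent dim by metis
  have "gen_algebra m f \<subseteq> poly_ring r"
    unfolding gen_algebra_def
    by (rule hull_minimal) (auto simp: k_subalgebra_def f intro: poly_ring_add poly_ring_mult)
  moreover have "gen_algebra m f \<subseteq> {p. D p = 0}"
    unfolding gen_algebra_def
    by (rule hull_minimal) (auto simp: k_subalgebra_def Df derivation_simps[OF D])
  ultimately have "set (Var i # as) \<subseteq> poly_ring r" "algebraically_independent (Var i # as)"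
    using as i \<open>D (Var i) \<noteq> 0\<close> by (auto intro!: algebraically_independent_Cons[OF D] Var_in_poly_ring)
  then show False
    using not_algebraically_independent[of "Var i # as" r] as(1) by simp
qed

section \<open>Expansion in monomials of the remaining variables\<close>

definition part :: "nat set \<Rightarrow> (nat \<Rightarrow>\<^sub>0 nat) \<Rightarrow> nat \<Rightarrow>\<^sub>0 nat" where
  "part I a = Poly_Mapping.mapp (\<lambda>i e. e when i \<in> I) a"

lemma lookup_part: "Poly_Mapping.lookup (part I a) i = (Poly_Mapping.lookup a i when i \<in> I)"
  by (simp add: part_def lookup_mapp when_def in_keys_iff)

lemma keys_part: "Poly_Mapping.keys (part I a) = Poly_Mapping.keys a \<inter> I"
  by (auto simp: in_keys_iff lookup_part when_def split: if_splits)

lemma part_add: "part I (a + b) = part I a + part I b"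
  by (rule poly_mapping_eqI) (simp add: lookup_part lookup_add when_def)

lemma part_Compl: "part (- I) a + part I a = a"
  by (rule poly_mapping_eqI) (simp add: lookup_part lookup_add when_def)

lemma part_ident: "Poly_Mapping.keys a \<subseteq> I \<Longrightarrow> part I a = a"
  by (rule poly_mapping_eqI) (auto simp: lookup_part when_def in_keys_iff)

lemma part_disjoint: "Poly_Mapping.keys a \<subseteq> I \<Longrightarrow> part (- I) a = 0"
  by (rule poly_mapping_eqI) (auto simp: lookup_part when_def in_keys_iff)

text \<open>
  A polynomial in all variables is a combination of monomials in the variables other than
  \<open>x\<^sub>1,\<dots>,x\<^sub>r\<close>, with coefficients in \<open>R = k[x\<^sub>1,\<dots>,x\<^sub>r]\<close>; \<open>slice r g p\<close> is the coefficient at exponent \<open>g\<close>.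
\<close>

definition slice :: "nat \<Rightarrow> (nat \<Rightarrow>\<^sub>0 nat) \<Rightarrow> 'k::comm_ring_1 mpoly \<Rightarrow> 'k mpoly" where
  "slice r g p = (\<Sum>a\<in>Poly_Mapping.keys p.
     Poly_Mapping.single (part {1..r} a) (Poly_Mapping.lookup p a) when part (- {1..r}) a = g)"

lemma slice_0 [simp]: "slice r g 0 = 0"
  by (simp add: slice_def)

lemma slice_add: "slice r g (p + q) = slice r g p + slice r g q"
  unfolding slice_def by (rule setsum_keys_plus_distrib) (simp_all add: single_add when_def)

lemma slice_sum: "slice r g (\<Sum>i\<in>I. p i) = (\<Sum>i\<in>I. slice r g (p i))"
  by (induction I rule: infinite_finite_induct) (simp_all add: slice_add)

lemma slice_single:
  "slice r g (Poly_Mapping.single a c)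
    = (Poly_Mapping.single (part {1..r} a) c when part (- {1..r}) a = g)"
  by (simp add: slice_def)

lemma slice_in_poly_ring: "slice r g p \<in> poly_ring r"
  unfolding slice_def
  by (rule poly_ring_sum) (simp add: when_def poly_ring_iff keys_part)

text \<open>
  Taking coefficients is \<open>R\<close>-linear, so the coefficients of a solution over \<open>S\<close> of linear equations
  with coefficients in \<open>R\<close> are solutions over \<open>R\<close>.
\<close>

lemma slice_mult:
  assumes "q \<in> poly_ring r"
  shows "slice r g (p * q) = slice r g p * q"
proof (induction q rule: mpoly_induct_single)
  case (single b e)
  then have b: "Poly_Mapping.keys b \<subseteq> {1..r}"
    using assms by (simp add: poly_ring_iff)
  show ?case
  proof (induction p rule: mpoly_induct_single)
    case (single a c)
    show ?case
      using b by (simp add: mult_single slice_single part_add part_ident part_disjoint when_def)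
  qed (simp_all add: slice_add distrib_right)
qed (simp_all add: slice_add distrib_left)

text \<open>
  The index set may exceed the exponents that occur in \<open>p\<close>, so that all components of a vector can be
  expanded over the same monomials.
\<close>

lemma sum_slices:
  assumes "finite \<Gamma>" "part (- {1..r}) ` Poly_Mapping.keys p \<subseteq> \<Gamma>"
  shows "p = (\<Sum>g\<in>\<Gamma>. Poly_Mapping.single g 1 * slice r g p)"
proof (induction p rule: mpoly_induct_single)
  case (single a c)
  let ?g = "part (- {1..r}) a"
  have "(\<Sum>g\<in>\<Gamma>. Poly_Mapping.single g 1 * slice r g (Poly_Mapping.single a c))
      = (\<Sum>g\<in>\<Gamma>. if g = ?g then Poly_Mapping.single (?g + part {1..r} a) c else 0)"
    by (intro sum.cong) (auto simp: slice_single mult_single when_def)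
  also have "\<dots> = Poly_Mapping.single (?g + part {1..r} a) c"
    using assms single by auto
  finally show ?case
    by (simp add: part_Compl)
next
  case (add p q)
  have "(\<Sum>g\<in>\<Gamma>. Poly_Mapping.single g 1 * slice r g (p + q))
      = (\<Sum>g\<in>\<Gamma>. Poly_Mapping.single g 1 * slice r g p)
        + (\<Sum>g\<in>\<Gamma>. Poly_Mapping.single g 1 * slice r g q)"
    by (simp only: slice_add distrib_left sum.distrib)
  also have "\<dots> = p + q"
    by (simp only: add[symmetric])
  finally show ?case ..
qed simp

section \<open>The partial derivatives of the generic combination of \<open>f\<^sub>1,\<dots>,f\<^sub>m\<close>\<close>

lemma sum_split_shift: "(\<Sum>j=1..r + m. g j) = (\<Sum>i=1..r. g i) + (\<Sum>j=1..m. g (r + j))"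
  for g :: "nat \<Rightarrow> 'b::comm_monoid_add"
proof -
  have "(\<Sum>j=1..r + m. g j) = (\<Sum>i=1..r. g i) + (\<Sum>j=r + 1..r + m. g j)"
    by (rule sum.ub_add_nat) simp
  also have "(\<Sum>j=r + 1..r + m. g j) = (\<Sum>j=1..m. g (r + j))"
    by (rule sum.reindex_bij_witness[of _ "\<lambda>j. r + j" "\<lambda>j. j - r"]) auto
  finally show ?thesis .
qed

locale generic_combination =
  fixes r m :: nat and f :: "nat \<Rightarrow> 'k::field_char_0 mpoly" and F :: "'k mpoly"
  assumes f_in: "\<And>j. j \<in> {1..m} \<Longrightarrow> f j \<in> poly_ring r"
    and F_eq: "F = (\<Sum>j=1..m. Var (r + j) * f j)"
begin

abbreviation h :: "nat \<Rightarrow> 'k mpoly" where "h i \<equiv> pdiff i F"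

text \<open>
  The inclusion of the free module on \<open>dT\<^sub>r\<^sub>+\<^sub>1,\<dots>,dT\<^sub>r\<^sub>+\<^sub>m\<close> into the one on all \<open>dT\<^sub>1,\<dots>,dT\<^sub>r\<^sub>+\<^sub>m\<close>, with the
  indices of the source starting at \<open>1\<close>.
\<close>

definition pad :: "(nat \<Rightarrow> 'k mpoly) \<Rightarrow> nat \<Rightarrow> 'k mpoly" where
  "pad w i = (if i \<in> {r + 1..r + m} then w (i - r) else 0)"

text \<open>
  The retraction \<open>S \<rightarrow> R\<close> that sets the new variables to zero.
\<close>

definition at_0 :: "'k mpoly \<Rightarrow> 'k mpoly" where
  "at_0 = subst_poly (\<lambda>i. if i \<le> r then Var i else 0)"

lemma f_in_S: "j \<in> {1..m} \<Longrightarrow> f j \<in> poly_ring (r + m)"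
  using f_in poly_ring_mono[of r "r + m"] by auto

lemma h_in: "h i \<in> poly_ring (r + m)"
  unfolding F_eq
  by (auto intro!: pdiff_in_poly_ring poly_ring_sum poly_ring_mult Var_in_poly_ring f_in_S)

lemma h_high:
  assumes "j \<in> {1..m}"
  shows "h (r + j) = f j"
proof -
  have "h (r + j) = (\<Sum>l=1..m. if l = j then f l else 0)"
    unfolding F_eq derivation_sum[OF derivation_pdiff]
    using assms by (intro sum.cong) (auto simp: pdiff_mult pdiff_Var pdiff_eq_0[OF f_in])
  then show ?thesis
    using assms by simp
qed

lemma h_low:
  assumes "i \<in> {1..r}"
  shows "h i = (\<Sum>l=1..m. Var (r + l) * pdiff i (f l))"
  unfolding F_eq derivation_sum[OF derivation_pdiff]
  using assms by (intro sum.cong) (auto simp: pdiff_mult pdiff_Var)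

lemma pdiff_h_low:
  assumes "i \<in> {1..r}" "j \<in> {1..m}"
  shows "pdiff (r + j) (h i) = pdiff i (f j)"
proof -
  have "pdiff (r + j) (h i) = (\<Sum>l=1..m. if l = j then pdiff i (f l) else 0)"
    unfolding h_low[OF assms(1)] derivation_sum[OF derivation_pdiff]
    using assms by (intro sum.cong)
      (auto simp: pdiff_mult pdiff_Var pdiff_eq_0[OF pdiff_in_poly_ring[OF f_in]])
  then show ?thesis
    using assms by simp
qed

text \<open>
  Since \<open>F\<close> is linear in the new variables, the equations of a syzygy \<open>v\<close> that belong to
  \<open>\<partial>/\<partial>x\<^sub>r\<^sub>+\<^sub>j\<close> say that the derivation \<open>\<Sum>\<^sub>i\<^sub>\<le>\<^sub>r v\<^sub>i \<partial>/\<partial>x\<^sub>i\<close> kills every \<open>f\<^sub>j\<close>.  As \<open>dim A = r\<close>, this derivation kills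
  \<open>x\<^sub>1,\<dots>,x\<^sub>r\<close>, where its values are the \<open>v\<^sub>i\<close>.
\<close>

lemma syzygy_low_part_eq_0:
  assumes "krull_dim (ring_on (gen_algebra m f)) = enat r"
    and v: "v \<in> differential_syzygies (r + m) (r + m) h" and "i \<in> {1..r}"
  shows "v i = 0"
proof -
  define D where "D = (\<lambda>p. \<Sum>i=1..r. v i * pdiff i p)"
  have "D (f j) = 0" if "j \<in> {1..m}" for j
  proof -
    have "0 = (\<Sum>i=1..r + m. v i * pdiff (r + j) (h i))"
      using v that by (simp add: differential_syzygies_iff)
    also have "\<dots> = (\<Sum>i=1..r. v i * pdiff (r + j) (h i))
        + (\<Sum>l=1..m. v (r + l) * pdiff (r + j) (h (r + l)))"
      by (rule sum_split_shift)
    also have "(\<Sum>l=1..m. v (r + l) * pdiff (r + j) (h (r + l))) = 0"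
      using that by (intro sum.neutral) (simp add: h_high pdiff_eq_0[OF f_in])
    also have "(\<Sum>i=1..r. v i * pdiff (r + j) (h i)) = D (f j)"
      unfolding D_def using that by (intro sum.cong) (simp_all add: pdiff_h_low)
    finally show ?thesis by simp
  qed
  moreover have "derivation D"
    unfolding D_def by (rule derivation_combination)
  ultimately have "D (Var i) = 0"
    using derivation_vanishing_on_gen_algebra[OF assms(1) f_in, of D i] assms(3) by blast
  moreover have "D (Var i) = v i"
    using assms(3) by (simp add: D_def pdiff_Var if_distrib sum.delta' cong: if_cong)
  ultimately show ?thesis by simp
qed

text \<open>
  For a syzygy without components in \<open>dT\<^sub>1,\<dots>,dT\<^sub>r\<close>, the conditions are those on a differential syzygy of
  \<open>f\<^sub>1,\<dots>,f\<^sub>m\<close>, with coefficients in \<open>S\<close> instead of \<open>R\<close>.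
\<close>

lemma differential_syzygies_h_iff:
  assumes "\<And>i. i \<in> {1..r} \<Longrightarrow> v i = 0"
  shows "v \<in> differential_syzygies (r + m) (r + m) h \<longleftrightarrow> v \<in> free_module (r + m) (r + m)
    \<and> (\<forall>i\<in>{1..r}. (\<Sum>j=1..m. v (r + j) * pdiff i (f j)) = 0)"
proof -
  have sum: "(\<Sum>j=1..r + m. v j * pdiff i (h j)) = (\<Sum>j=1..m. v (r + j) * pdiff i (f j))" for i
    unfolding sum_split_shift using assms by (simp add: h_high)
  have "pdiff i (f j) = 0" if "i \<notin> {1..r}" "j \<in> {1..m}" for i j
    using that f_in pdiff_eq_0 by blast
  then have "(\<Sum>j=1..m. v (r + j) * pdiff i (f j)) = 0" if "i \<notin> {1..r}" for i
    using that by (intro sum.neutral) (simp del: atLeastAtMost_iff)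
  moreover have "{1..r} \<subseteq> {1..r + m}"
    by auto
  ultimately show ?thesis
    unfolding differential_syzygies_iff sum by blast
qed

lemma pad_in_free_module:
  assumes "\<And>j. j \<in> {1..m} \<Longrightarrow> w j \<in> poly_ring (r + m)"
  shows "pad w \<in> free_module (r + m) (r + m)"
  unfolding free_module_def
proof (intro CollectI conjI ballI allI impI)
  fix i
  show "pad w i \<in> poly_ring (r + m)"
  proof (cases "i \<in> {r + 1..r + m}")
    case True
    then have "i - r \<in> {1..m}"
      unfolding atLeastAtMost_iff by arith
    then show ?thesis
      using assms True by (simp add: pad_def)
  next
    case False
    then show ?thesis
      by (simp only: pad_def if_False zero_in_poly_ring)
  qed
qed (auto simp: pad_def)

lemma pad_differential_syzygy:
  assumes "w \<in> differential_syzygies r m f"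
  shows "pad w \<in> differential_syzygies (r + m) (r + m) h"
proof (subst differential_syzygies_h_iff)
  have "w j \<in> poly_ring (r + m)" if "j \<in> {1..m}" for j
    using assms that poly_ring_mono[of r "r + m"] by (auto simp: differential_syzygies_iff free_module_def)
  moreover have "pad w (r + j) = w j" if "j \<in> {1..m}" for j
    using that by (simp add: pad_def)
  ultimately show "pad w \<in> free_module (r + m) (r + m)
      \<and> (\<forall>i\<in>{1..r}. (\<Sum>j=1..m. pad w (r + j) * pdiff i (f j)) = 0)"
    using assms by (auto simp: differential_syzygies_iff intro: pad_in_free_module)
qed (simp add: pad_def)

lemma subst_h_shift:
  assumes "G \<in> poly_ring m"
  shows "subst_poly h (subst_poly (\<lambda>j. Var (r + j)) G) = subst_poly f G"
  unfolding subst_poly_subst_poly[OF assms]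
  using h_high by (intro subst_poly_cong[OF assms]) simp

text \<open>
  A relation \<open>G\<close> among the \<open>f\<^sub>j\<close> is a relation among the partial derivatives of \<open>F\<close> after shifting its
  variables, as \<open>\<partial>F/\<partial>x\<^sub>r\<^sub>+\<^sub>j = f\<^sub>j\<close>.
\<close>

lemma pad_polar_syzygy:
  assumes "w \<in> polar_syzygies r m f"
  shows "pad w \<in> polar_syzygies (r + m) (r + m) h"
  using assms unfolding polar_syzygies_def[of r]
proof (rule hull_induct)
  fix w assume "w \<in> {(\<lambda>j. if j \<in> {1..m} then subst_poly f (pdiff j G) else 0) | G.
      G \<in> presentation_ideal m f}"
  then obtain G where G: "G \<in> poly_ring m" "subst_poly f G = 0"
    and w: "w = (\<lambda>j. if j \<in> {1..m} then subst_poly f (pdiff j G) else 0)"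
    by (auto simp: presentation_ideal_def)
  define H where "H = subst_poly (\<lambda>j. Var (r + j)) G"
  have "H \<in> poly_ring (r + m)"
    unfolding H_def using G by (intro subst_poly_in_poly_ring[of G m] Var_in_poly_ring) auto
  then have H: "H \<in> presentation_ideal (r + m) h"
    using G by (simp add: H_def presentation_ideal_def subst_h_shift)
  have diff: "pdiff i H = (\<Sum>j=1..m. subst_poly (\<lambda>j. Var (r + j)) (pdiff j G) * (if i = r + j then 1 else 0))" for i
    unfolding H_def derivation_subst_poly[OF derivation_pdiff G(1)] by (simp add: pdiff_Var)
  have "subst_poly h (pdiff i H) = pad w i" for i
  proof (cases "i \<in> {r + 1..r + m}")
    case True
    then have "pdiff i H = (\<Sum>j=1..m. if j = i - r then subst_poly (\<lambda>j. Var (r + j)) (pdiff j G) else 0)"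
      unfolding diff by (intro sum.cong) auto
    also have "\<dots> = subst_poly (\<lambda>j. Var (r + j)) (pdiff (i - r) G)"
      using True by auto
    finally show ?thesis
      using True by (auto simp: w pad_def subst_h_shift pdiff_in_poly_ring[OF G(1)])
  next
    case False
    then have "pdiff i H = 0"
      unfolding diff by (intro sum.neutral) auto
    then show ?thesis
      using False by (simp only: pad_def if_False subst_poly_0)
  qed
  then have "(\<lambda>j. if j \<in> {1..r + m} then subst_poly h (pdiff j H) else 0) = pad w"
    by (auto simp: pad_def)
  then show "pad w \<in> polar_syzygies (r + m) (r + m) h"
    unfolding polar_syzygies_def using H by (intro hull_inc) (auto intro!: exI[of _ H])
next
  have N: "submodule_over (poly_ring (r + m)) (polar_syzygies (r + m) (r + m) h)"
    by (rule submodule_polar_syzygies)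
  have "pad (\<lambda>j. 0) = (\<lambda>j. 0)" "pad (\<lambda>j. v j + w j) = (\<lambda>j. pad v j + pad w j)"
    "pad (\<lambda>j. u * v j) = (\<lambda>j. u * pad v j)" for u v w
    by (auto simp: pad_def)
  then show "submodule_over (poly_ring r) {w. pad w \<in> polar_syzygies (r + m) (r + m) h}"
    using N poly_ring_mono[of r "r + m"] unfolding submodule_over_def by auto
qed

lemma at_0_ident: "p \<in> poly_ring r \<Longrightarrow> at_0 p = p"
  unfolding at_0_def by (rule subst_poly_ident) auto

lemma at_0_h:
  assumes "i \<in> {1..r + m}"
  shows "at_0 (h i) = (if i \<le> r then 0 else f (i - r))"
proof (cases "i \<le> r")
  case True
  then have "h i = (\<Sum>l=1..m. Var (r + l) * pdiff i (f l))"
    using assms by (intro h_low) simp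
  then show ?thesis
    using True by (auto simp: at_0_def subst_poly_sum subst_poly_mult intro!: sum.neutral)
next
  case False
  then have "i - r \<in> {1..m}" "r + (i - r) = i"
    using assms by auto
  then have "h i = f (i - r)" "f (i - r) \<in> poly_ring r"
    using h_high[of "i - r"] f_in[of "i - r"] by simp_all
  then show ?thesis
    using False by (simp add: at_0_ident)
qed

text \<open>
  Setting the new variables to zero sends \<open>\<partial>F/\<partial>x\<^sub>i\<close> to \<open>0\<close> for \<open>i \<le> r\<close> and fixes \<open>\<partial>F/\<partial>x\<^sub>r\<^sub>+\<^sub>j = f\<^sub>j\<close>.
  Hence a relation \<open>G\<close> among the partial derivatives of \<open>F\<close> becomes the relation
  \<open>G(0,\<dots>,0,T\<^sub>1,\<dots>,T\<^sub>m)\<close> among the \<open>f\<^sub>j\<close>, and its polar syzygy becomes the polar syzygy of that relation.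
\<close>

lemma at_0_polar_syzygy:
  assumes "v \<in> polar_syzygies (r + m) (r + m) h"
  shows "(\<lambda>j. if j \<in> {1..m} then at_0 (v (r + j)) else 0) \<in> polar_syzygies r m f"
  using assms unfolding polar_syzygies_def[of "r + m"]
proof (rule hull_induct)
  fix v assume "v \<in> {(\<lambda>j. if j \<in> {1..r + m} then subst_poly h (pdiff j G) else 0) | G.
      G \<in> presentation_ideal (r + m) h}"
  then obtain G where G: "G \<in> poly_ring (r + m)" "subst_poly h G = 0"
    and v: "v = (\<lambda>j. if j \<in> {1..r + m} then subst_poly h (pdiff j G) else 0)"
    by (auto simp: presentation_ideal_def)
  define \<pi> :: "nat \<Rightarrow> 'k mpoly" where "\<pi> = (\<lambda>i. if i \<le> r then 0 else Var (i - r))"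
  have subst: "subst_poly f (subst_poly \<pi> H) = at_0 (subst_poly h H)" if "H \<in> poly_ring (r + m)" for H
  proof -
    have "at_0 (subst_poly h H) = subst_poly (\<lambda>i. at_0 (h i)) H"
      unfolding at_0_def by (rule subst_poly_subst_poly[OF that])
    also have "\<dots> = subst_poly (\<lambda>i. subst_poly f (\<pi> i)) H"
      by (rule subst_poly_cong[OF that]) (simp add: at_0_h \<pi>_def)
    finally show ?thesis
      by (simp add: subst_poly_subst_poly[OF that])
  qed
  have "subst_poly \<pi> G \<in> poly_ring m"
    by (rule subst_poly_in_poly_ring[OF G(1)]) (auto simp: \<pi>_def intro!: Var_in_poly_ring)
  then have "subst_poly \<pi> G \<in> presentation_ideal m f"
    using subst[OF G(1)] G(2) by (simp add: presentation_ideal_def at_0_def)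
  moreover have "pdiff j (subst_poly \<pi> G) = subst_poly \<pi> (pdiff (r + j) G)" if "j \<in> {1..m}" for j
  proof -
    have "pdiff j (subst_poly \<pi> G)
        = (\<Sum>i=1..r + m. if i = r + j then subst_poly \<pi> (pdiff i G) else 0)"
      unfolding derivation_subst_poly[OF derivation_pdiff G(1)]
      using that by (intro sum.cong) (auto simp: \<pi>_def pdiff_Var)
    then show ?thesis
      using that by simp
  qed
  then have "(\<lambda>j. if j \<in> {1..m} then at_0 (v (r + j)) else 0)
      = (\<lambda>j. if j \<in> {1..m} then subst_poly f (pdiff j (subst_poly \<pi> G)) else 0)"
    by (auto simp: v subst pdiff_in_poly_ring[OF G(1)])
  ultimately show "(\<lambda>j. if j \<in> {1..m} then at_0 (v (r + j)) else 0) \<in> polar_syzygies r m f"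
    unfolding polar_syzygies_def by (intro hull_inc) blast
next
  let ?\<rho> = "\<lambda>v j. if j \<in> {1..m} then at_0 (v (r + j)) else 0"
  have "?\<rho> (\<lambda>j. 0) = (\<lambda>j. 0)" "?\<rho> (\<lambda>j. v j + w j) = (\<lambda>j. ?\<rho> v j + ?\<rho> w j)"
    "?\<rho> (\<lambda>j. u * v j) = (\<lambda>j. at_0 u * ?\<rho> v j)" for u v w
    by (auto simp: at_0_def subst_poly_add subst_poly_mult)
  moreover have "at_0 u \<in> poly_ring r" if "u \<in> poly_ring (r + m)" for u
    unfolding at_0_def by (rule subst_poly_in_poly_ring[OF that]) (auto intro: Var_in_poly_ring)
  ultimately show "submodule_over (poly_ring (r + m)) {v. ?\<rho> v \<in> polar_syzygies r m f}"
    using submodule_polar_syzygies[of r m f] unfolding submodule_over_def by auto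
qed

lemma differential_syzygies_f_subset_polar:
  assumes "differential_syzygies (r + m) (r + m) h \<subseteq> polar_syzygies (r + m) (r + m) h"
  shows "differential_syzygies r m f \<subseteq> polar_syzygies r m f"
proof
  fix w assume w: "w \<in> differential_syzygies r m f"
  have "(\<lambda>j. if j \<in> {1..m} then at_0 (pad w (r + j)) else 0) \<in> polar_syzygies r m f"
    using pad_differential_syzygy[OF w] assms by (intro at_0_polar_syzygy) blast
  moreover have "(\<lambda>j. if j \<in> {1..m} then at_0 (pad w (r + j)) else 0) = w"
    using w by (auto simp: pad_def at_0_ident differential_syzygies_iff free_module_def fun_eq_iff)
  ultimately show "w \<in> polar_syzygies r m f"
    by simp
qed

text \<open>
  A syzygy of the partial derivatives of \<open>F\<close> is a syzygy of the \<open>f\<^sub>j\<close> with coefficients in \<open>S\<close>.  Its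
  coefficients at the monomials in the new variables are syzygies of the \<open>f\<^sub>j\<close> over \<open>R\<close>, hence polar.
\<close>

lemma differential_syzygies_h_subset_polar:
  assumes "krull_dim (ring_on (gen_algebra m f)) = enat r"
    and "differential_syzygies r m f \<subseteq> polar_syzygies r m f"
  shows "differential_syzygies (r + m) (r + m) h \<subseteq> polar_syzygies (r + m) (r + m) h"
proof
  fix v assume v: "v \<in> differential_syzygies (r + m) (r + m) h"
  have low: "v i = 0" if "i \<in> {1..r}" for i
    using syzygy_low_part_eq_0[OF assms(1) v that] .
  have v_in: "v \<in> free_module (r + m) (r + m)"
    and high: "\<And>i. i \<in> {1..r} \<Longrightarrow> (\<Sum>j=1..m. v (r + j) * pdiff i (f j)) = 0"
    using v differential_syzygies_h_iff[of v] low by blast+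
  define \<Gamma> where "\<Gamma> = (\<Union>j\<in>{1..m}. part (- {1..r}) ` Poly_Mapping.keys (v (r + j)))"
  define w where "w = (\<lambda>g j. if j \<in> {1..m} then slice r g (v (r + j)) else 0)"
  have "w g \<in> differential_syzygies r m f" for g
    unfolding differential_syzygies_iff
  proof (intro conjI ballI)
    show "w g \<in> free_module r m"
      by (auto simp: free_module_def w_def slice_in_poly_ring)
    fix i assume i: "i \<in> {1..r}"
    have "(\<Sum>j=1..m. w g j * pdiff i (f j)) = slice r g (\<Sum>j=1..m. v (r + j) * pdiff i (f j))"
      by (simp add: w_def slice_sum slice_mult pdiff_in_poly_ring f_in)
    then show "(\<Sum>j=1..m. w g j * pdiff i (f j)) = 0"
      using high[OF i] by simp
  qed
  then have "pad (w g) \<in> polar_syzygies (r + m) (r + m) h" for g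
    using assms(2) by (intro pad_polar_syzygy) blast
  moreover have "Poly_Mapping.single g 1 \<in> poly_ring (r + m)" if "g \<in> \<Gamma>" for g
  proof -
    obtain j a where "j \<in> {1..m}" "a \<in> Poly_Mapping.keys (v (r + j))" "g = part (- {1..r}) a"
      using \<open>g \<in> \<Gamma>\<close> by (auto simp: \<Gamma>_def)
    moreover from this have "v (r + j) \<in> poly_ring (r + m)"
      using v_in by (simp add: free_module_def)
    ultimately show ?thesis
      by (auto simp: poly_ring_iff keys_part)
  qed
  ultimately have "(\<lambda>i. \<Sum>g\<in>\<Gamma>. Poly_Mapping.single g 1 * pad (w g) i)
      \<in> polar_syzygies (r + m) (r + m) h"
    by (intro submodule_over_sum[OF submodule_polar_syzygies]
        submodule_over_scale[OF submodule_polar_syzygies]) blast+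
  moreover have "(\<Sum>g\<in>\<Gamma>. Poly_Mapping.single g 1 * pad (w g) i) = v i" for i
  proof (cases "i \<in> {r + 1..r + m}")
    case True
    then have j: "i - r \<in> {1..m}" "r + (i - r) = i"
      unfolding atLeastAtMost_iff by arith+
    have "part (- {1..r}) ` Poly_Mapping.keys (v (r + (i - r))) \<subseteq> \<Gamma>"
      unfolding \<Gamma>_def using j(1) by blast
    then have "v i = (\<Sum>g\<in>\<Gamma>. Poly_Mapping.single g 1 * slice r g (v i))"
      using j(2) by (intro sum_slices) (simp_all add: \<Gamma>_def)
    also have "\<dots> = (\<Sum>g\<in>\<Gamma>. Poly_Mapping.single g 1 * pad (w g) i)"
      using True j(1) by (simp only: pad_def w_def if_True j(2))
    finally show ?thesis ..
  next
    case False
    then have "v i = 0"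
      using low[of i] v_in by (cases "i \<in> {1..r}") (auto simp: free_module_def)
    moreover have "pad (w g) i = 0" for g
      using False by (simp only: pad_def if_False)
    ultimately show ?thesis by simp
  qed
  ultimately show "v \<in> polar_syzygies (r + m) (r + m) h"
    by simp
qed

end

section \<open>Polarizability of \<open>A\<close> and \<open>B\<close>\<close>

theorem proposition6p3:
  fixes f :: "nat \<Rightarrow> 'k::field_char_0 mpoly"
    and F :: "'k mpoly"
    and n r d :: nat
  assumes "n \<ge> r + 1"
    and "d \<ge> 2"
    and "\<And>j. j \<in> {1..n - r} \<Longrightarrow> f j \<in> poly_ring r"
    and "\<And>j. j \<in> {1..n - r} \<Longrightarrow> form_of_degree d (f j)"
    and "F = (\<Sum>j=1..n - r. Var (r + j) * f j)"
    and "krull_dim (ring_on (gen_algebra (n - r) f)) = enat r"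
  shows "polarizable n n (\<lambda>i. pdiff i F) \<longleftrightarrow> polarizable r (n - r) f"
proof -
  interpret generic_combination r "n - r" f F
    by unfold_locales (fact assms(3), fact assms(5))
  have n: "r + (n - r) = n"
    using assms(1) by simp
  have "polar_syzygies r (n - r) f \<subseteq> differential_syzygies r (n - r) f"
    by (rule polar_subset_differential_syzygies[OF assms(3)])
  moreover have "polar_syzygies n n h \<subseteq> differential_syzygies n n h"
    using h_in n by (intro polar_subset_differential_syzygies) simp
  ultimately show ?thesis
    using differential_syzygies_f_subset_polar differential_syzygies_h_subset_polar[OF assms(6)]
    unfolding polarizable_def n by blast
qed

end
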